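(* Let $X$ be a countably infinite set and $(b,c)$ a connected canonically compactifiable graph over $X$. Then $(b,c)$ is uniformly transient.
   Context: $C(X)$ denotes the real-valued functions on $X$, $C_c(X)$ those with finite support, $\ell^\infty(X)$ the bounded ones, $\|f\|_\infty=\sup_X|f|$, and $C_0(X)$ is the closure of $C_c(X)$ with respect to $\|\cdot\|_\infty$. A graph $(b,c)$ over $X$ consists of a symmetric $b:X\times X\to[0,\infty)$ with zero diagonal and $\sum_{y}b(x,y)<\infty$ for all $x$, and an arbitrary $c:X\to[0,\infty)$. It is connected if for any two distinct $x,y\in X$ there are $x=x_0,\dots,x_n=y$ with $b(x_{i-1},x_i)>0$ for $i=1,\dots,n$. For $f\in C(X)$ put $\widetilde Q(f)=\frac12\sum_{x,y}b(x,y)|f(x)-f(y)|^2+\sum_x c(x)|f(x)|^2\in[0,\infty]$ and $\widetilde D=\{f\in C(X):\widetilde Q(f)<\infty\}$. For $o\in X$ put $\|f\|_o=(\widetilde Q(f)+|f(o)|^2)^{1/2}$; $\widetilde D_0$ is the closure of $C_c(X)$ in $\widetilde D$ with respect to $\|\cdot\|_o$ (independent of $o$ for connected graphs). A connected graph is canonically compactifiable if $\widetilde D\subseteq\ell^\infty(X)$, and uniformly transient if $\widetilde D_0\subseteq C_0(X)$ (equivalently, there is $C\ge 0$ with $\|\varphi\|_\infty\le C\widetilde Q^{1/2}(\varphi)$ for all $\varphi\in C_c(X)$). *)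

theory Defs
  imports "HOL-Analysis.Analysis"
begin

text \<open>
  The vertex set \<open>X\<close> is the universe of the type \<open>'a\<close>, so that \<open>C(X)\<close> is the type
  \<open>'a \<Rightarrow> real\<close>.
\<close>

definition weighted_graph :: "('a \<Rightarrow> 'a \<Rightarrow> real) \<Rightarrow> ('a \<Rightarrow> real) \<Rightarrow> bool" where
  "weighted_graph b c \<longleftrightarrow>
     (\<forall>x y. 0 \<le> b x y) \<and> (\<forall>x y. b x y = b y x) \<and> (\<forall>x. b x x = 0) \<and>
     (\<forall>x. b x summable_on UNIV) \<and> (\<forall>x. 0 \<le> c x)"

definition connected_graph :: "('a \<Rightarrow> 'a \<Rightarrow> real) \<Rightarrow> bool" where
  "connected_graph b \<longleftrightarrow> (\<forall>x y. x \<noteq> y \<longrightarrow> (\<lambda>u v. 0 < b u v)\<^sup>*\<^sup>* x y)"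

definition finite_support_functions :: "('a \<Rightarrow> real) set" where
  "finite_support_functions = {f. finite {x. f x \<noteq> 0}}"

text \<open>Norms take values in \<open>[0,\<infinity>]\<close>, so that they are meaningful on all of \<open>C(X)\<close>.\<close>

definition sup_norm :: "('a \<Rightarrow> real) \<Rightarrow> ennreal" where
  "sup_norm f = (SUP x. ennreal \<bar>f x\<bar>)"

definition bounded_functions :: "('a \<Rightarrow> real) set" where
  "bounded_functions = {f. sup_norm f < \<infinity>}"

definition closure_in ::
    "(('a \<Rightarrow> real) \<Rightarrow> ennreal) \<Rightarrow> ('a \<Rightarrow> real) set \<Rightarrow> ('a \<Rightarrow> real) set \<Rightarrow> ('a \<Rightarrow> real) set" where
  "closure_in N V S = {f \<in> V. \<forall>\<epsilon>>0. \<exists>\<phi>\<in>S. N (\<lambda>x. f x - \<phi> x) < ennreal \<epsilon>}"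

definition C0_functions :: "('a \<Rightarrow> real) set" where
  "C0_functions = closure_in sup_norm UNIV finite_support_functions"

definition energy :: "('a \<Rightarrow> 'a \<Rightarrow> real) \<Rightarrow> ('a \<Rightarrow> real) \<Rightarrow> ('a \<Rightarrow> real) \<Rightarrow> ennreal" where
  "energy b c f =
     (\<Sum>\<^sub>\<infinity>(x, y)\<in>UNIV. ennreal (b x y * \<bar>f x - f y\<bar>\<^sup>2)) / 2
     + (\<Sum>\<^sub>\<infinity>x\<in>UNIV. ennreal (c x * \<bar>f x\<bar>\<^sup>2))"

definition finite_energy_functions ::
    "('a \<Rightarrow> 'a \<Rightarrow> real) \<Rightarrow> ('a \<Rightarrow> real) \<Rightarrow> ('a \<Rightarrow> real) set" where
  "finite_energy_functions b c = {f. energy b c f < \<infinity>}"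

text \<open>The case distinction is needed because \<open>enn2real \<infinity> = 0\<close>.\<close>

definition energy_norm ::
    "('a \<Rightarrow> 'a \<Rightarrow> real) \<Rightarrow> ('a \<Rightarrow> real) \<Rightarrow> 'a \<Rightarrow> ('a \<Rightarrow> real) \<Rightarrow> ennreal" where
  "energy_norm b c p f =
     (if energy b c f < \<infinity> then ennreal (sqrt (enn2real (energy b c f) + \<bar>f p\<bar>\<^sup>2)) else \<infinity>)"

definition finite_energy_functions0 ::
    "('a \<Rightarrow> 'a \<Rightarrow> real) \<Rightarrow> ('a \<Rightarrow> real) \<Rightarrow> 'a \<Rightarrow> ('a \<Rightarrow> real) set" where
  "finite_energy_functions0 b c p =
     closure_in (energy_norm b c p) (finite_energy_functions b c) finite_support_functions"

definition canonically_compactifiable :: "('a \<Rightarrow> 'a \<Rightarrow> real) \<Rightarrow> ('a \<Rightarrow> real) \<Rightarrow> bool" where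
  "canonically_compactifiable b c \<longleftrightarrow> finite_energy_functions b c \<subseteq> bounded_functions"

text \<open>
  For connected graphs the closure does not depend on the base point \<open>p\<close>; quantifying
  over all base points avoids building this fact into the definition.
\<close>

definition uniformly_transient :: "('a \<Rightarrow> 'a \<Rightarrow> real) \<Rightarrow> ('a \<Rightarrow> real) \<Rightarrow> bool" where
  "uniformly_transient b c \<longleftrightarrow> (\<forall>p. finite_energy_functions0 b c p \<subseteq> C0_functions)"

end

theory Submission
  imports Defs
begin

text \<open>
  A gliding hump argument shows that \<open>energy_norm b c p\<close> dominates the sup norm: otherwise
  there are \<open>f\<^sub>n\<close> with \<open>energy_norm b c p f\<^sub>n < 4\<^sup>-\<^sup>n\<close> and sup norm at least \<open>\<epsilon>\<close>, and
  the pointwise supremum \<open>g\<close> of the functions \<open>2\<^sup>n \<bar>f\<^sub>n\<bar>\<close> is unbounded. It is finite because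
  connectedness makes point evaluations continuous with respect to \<open>energy_norm b c p\<close>, and
  it has finite energy because \<open>\<bar>g x - g y\<bar>\<^sup>2\<close> is at most the sum of the
  \<open>4\<^sup>n \<bar>f\<^sub>n x - f\<^sub>n y\<bar>\<^sup>2\<close>, contradicting canonical compactifiability. Given the domination,
  approximation by finitely supported functions in energy norm is uniform approximation.
\<close>

lemma sum_le_infsum_ennreal:
  fixes f :: "'a \<Rightarrow> ennreal"
  assumes "finite F" "F \<subseteq> A"
  shows "sum f F \<le> infsum f A"
proof -
  have "infsum f F \<le> infsum f A"
    using assms by (intro infsum_mono_neutral nonneg_summable_on_complete) auto
  then show ?thesis
    using assms by simp
qed

text \<open>A finite sum can be exchanged with the series, and each finite sum of \<open>a n\<close>
  is below its \<open>infsum\<close>; hence the bound holds for every finite partial sum of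
  \<open>h\<close> and passes to the limit.\<close>

lemma infsum_le_suminf_ennreal:
  fixes h :: "'a \<Rightarrow> ennreal" and a :: "nat \<Rightarrow> 'a \<Rightarrow> ennreal"
  assumes "\<And>z. z \<in> A \<Longrightarrow> h z \<le> (\<Sum>n. k n * a n z)"
  shows "infsum h A \<le> (\<Sum>n. k n * infsum (a n) A)"
proof (rule infsum_le_finite_sums)
  fix F assume F: "finite F" "F \<subseteq> A"
  have "sum h F \<le> (\<Sum>z\<in>F. \<Sum>n. k n * a n z)"
    using F assms by (intro sum_mono) auto
  also have "\<dots> = (\<Sum>n. k n * sum (a n) F)"
    by (subst suminf_sum [symmetric]) (simp_all add: sum_distrib_left)
  also have "\<dots> \<le> (\<Sum>n. k n * infsum (a n) A)"
    using F by (intro suminf_le mult_left_mono sum_le_infsum_ennreal) auto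
  finally show "sum h F \<le> (\<Sum>n. k n * infsum (a n) A)" .
qed (simp add: nonneg_summable_on_complete)

text \<open>Energy is a nonnegative combination of squared differences and squared values, so
  pointwise domination of these squares carries over. The weights \<open>k n\<close> allow both a
  countable supremum and a rescaling to be handled.\<close>

lemma energy_le_suminf:
  fixes b :: "'a \<Rightarrow> 'a \<Rightarrow> real"
  assumes nonneg: "\<And>x y. 0 \<le> b x y" "\<And>x. 0 \<le> c x"
    and diff: "\<And>x y. ennreal (\<bar>g x - g y\<bar>\<^sup>2) \<le> (\<Sum>n. k n * ennreal (\<bar>f n x - f n y\<bar>\<^sup>2))"
    and val: "\<And>x. ennreal (\<bar>g x\<bar>\<^sup>2) \<le> (\<Sum>n. k n * ennreal (\<bar>f n x\<bar>\<^sup>2))"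
  shows "energy b c g \<le> (\<Sum>n. k n * energy b c (f n))"
proof -
  let ?B = "\<lambda>h (x, y). ennreal (b x y * \<bar>h x - h y\<bar>\<^sup>2)"
  let ?C = "\<lambda>h x. ennreal (c x * \<bar>h x\<bar>\<^sup>2)"
  \<comment> \<open>\<open>w\<close> stands for \<open>b x y\<close> or \<open>c x\<close>.\<close>
  have weighted: "ennreal (w * s) \<le> (\<Sum>n. k n * ennreal (w * t n))"
    if "ennreal s \<le> (\<Sum>n. k n * ennreal (t n))" "0 \<le> w" "0 \<le> s" "\<And>n. 0 \<le> t n"
    for w s :: real and t
  proof -
    have "ennreal (w * s) \<le> ennreal w * (\<Sum>n. k n * ennreal (t n))"
      using that by (simp add: ennreal_mult mult_left_mono)
    also have "\<dots> = (\<Sum>n. k n * ennreal (w * t n))"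
      using that by (simp add: ennreal_mult mult.left_commute flip: ennreal_suminf_cmult)
    finally show ?thesis .
  qed
  have "infsum (?B g) UNIV \<le> (\<Sum>n. k n * infsum (?B (f n)) UNIV)"
  proof (rule infsum_le_suminf_ennreal)
    fix z :: "'a \<times> 'a"
    show "?B g z \<le> (\<Sum>n. k n * ?B (f n) z)"
      unfolding case_prod_unfold by (rule weighted [OF diff]) (simp_all add: nonneg)
  qed
  moreover have "infsum (?C g) UNIV \<le> (\<Sum>n. k n * infsum (?C (f n)) UNIV)"
    by (rule infsum_le_suminf_ennreal, rule weighted [OF val]) (simp_all add: nonneg)
  ultimately have "energy b c g \<le>
      (\<Sum>n. k n * infsum (?B (f n)) UNIV) / 2 + (\<Sum>n. k n * infsum (?C (f n)) UNIV)"
    unfolding energy_def by (intro add_mono divide_right_mono_ennreal) auto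
  also have "\<dots> = (\<Sum>n. k n * energy b c (f n))"
    unfolding energy_def
    by (subst ennreal_suminf_divide [symmetric], subst suminf_add)
      (auto simp: distrib_left ennreal_times_divide)
  finally show ?thesis .
qed

text \<open>One ordered pair of the double sum is kept, which is why the factor 1/2 remains.\<close>

lemma edge_le_energy: "ennreal (b x y * \<bar>f x - f y\<bar>\<^sup>2) / 2 \<le> energy b c f"
proof -
  have "ennreal (b x y * \<bar>f x - f y\<bar>\<^sup>2)
      \<le> (\<Sum>\<^sub>\<infinity>(x, y)\<in>UNIV. ennreal (b x y * \<bar>f x - f y\<bar>\<^sup>2))"
    using sum_le_infsum_ennreal [of "{(x, y)}" UNIV "\<lambda>(x, y). ennreal (b x y * \<bar>f x - f y\<bar>\<^sup>2)"]
    by simp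
  then show ?thesis
    unfolding energy_def by (intro add_increasing2 divide_right_mono_ennreal) auto
qed

text \<open>Along a path from \<open>p\<close> to \<open>x\<close>, energy at most 1 limits the jump
  over each edge by a constant depending only on its weight. Adding these jumps gives a
  \<open>K\<close> independent of \<open>f\<close>.\<close>

lemma point_evaluation_bounded:
  assumes "connected_graph b"
  shows "\<exists>K. \<forall>f. energy b c f \<le> 1 \<longrightarrow> \<bar>f p\<bar> \<le> 1 \<longrightarrow> \<bar>f x\<bar> \<le> K"
proof -
  have "(\<lambda>u v. 0 < b u v)\<^sup>*\<^sup>* p x"
    using assms unfolding connected_graph_def by (cases "p = x") auto
  then show ?thesis
  proof (induction rule: rtranclp_induct)
    case base
    show ?case by blast
  next
    case (step y z)
    then obtain K where K: "\<And>f. energy b c f \<le> 1 \<Longrightarrow> \<bar>f p\<bar> \<le> 1 \<Longrightarrow> \<bar>f y\<bar> \<le> K"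
      by blast
    have "\<bar>f z\<bar> \<le> K + sqrt (2 / b y z)" if f: "energy b c f \<le> 1" "\<bar>f p\<bar> \<le> 1" for f
    proof -
      have "ennreal (b y z * \<bar>f y - f z\<bar>\<^sup>2) / 2 \<le> 1"
        using edge_le_energy f(1) by (rule order_trans)
      then have "ennreal (b y z * \<bar>f y - f z\<bar>\<^sup>2 / 2) \<le> ennreal 1"
        using step.hyps(2) by (simp add: divide_ennreal [symmetric] del: power2_abs)
      then have "\<bar>f y - f z\<bar>\<^sup>2 \<le> 2 / b y z"
        using step.hyps(2) by (simp add: field_simps)
      then have "\<bar>f y - f z\<bar> \<le> sqrt (2 / b y z)"
        by (rule real_le_rsqrt)
      with K [OF f] show ?thesis by linarith
    qed
    then show ?case by blast
  qed
qed

text \<open>This is the reverse triangle inequality for the sup norm on bounded sequences.\<close>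

lemma abs_SUP_abs_diff_le:
  fixes u v :: "nat \<Rightarrow> real"
  assumes "bdd_above (range (\<lambda>n. \<bar>u n\<bar>))" "bdd_above (range (\<lambda>n. \<bar>v n\<bar>))"
    and "\<And>n. \<bar>u n - v n\<bar> \<le> d"
  shows "\<bar>(SUP n. \<bar>u n\<bar>) - (SUP n. \<bar>v n\<bar>)\<bar> \<le> d"
proof -
  have "(SUP n. \<bar>s n\<bar>) \<le> (SUP n. \<bar>t n\<bar>) + d"
    if "bdd_above (range (\<lambda>n. \<bar>t n\<bar>))" "\<And>n. \<bar>s n - t n\<bar> \<le> d" for s t :: "nat \<Rightarrow> real"
  proof (rule cSUP_least)
    fix n
    show "\<bar>s n\<bar> \<le> (SUP n. \<bar>t n\<bar>) + d"
      using cSUP_upper [OF UNIV_I that(1), of n] that(2) [of n] by linarith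
  qed simp
  from this [of v u] this [of u v] assms show ?thesis
    by (fastforce simp: abs_minus_commute abs_le_iff)
qed

text \<open>Each term is at most the whole series, so the uniform distance of \<open>u\<close> and
  \<open>v\<close> is at most their square-sum distance; a divergent series makes the bound
  trivial.\<close>

lemma abs_SUP_abs_diff_square_le_suminf:
  fixes u v :: "nat \<Rightarrow> real"
  assumes "bdd_above (range (\<lambda>n. \<bar>u n\<bar>))" "bdd_above (range (\<lambda>n. \<bar>v n\<bar>))"
  shows "ennreal (\<bar>(SUP n. \<bar>u n\<bar>) - (SUP n. \<bar>v n\<bar>)\<bar>\<^sup>2) \<le> (\<Sum>n. ennreal (\<bar>u n - v n\<bar>\<^sup>2))"
proof (cases "(\<Sum>n. ennreal (\<bar>u n - v n\<bar>\<^sup>2))")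
  case (real s)
  have "\<bar>u n - v n\<bar> \<le> sqrt s" for n
  proof (rule real_le_rsqrt)
    have "(\<Sum>m\<in>{n}. ennreal (\<bar>u m - v m\<bar>\<^sup>2)) \<le> (\<Sum>m. ennreal (\<bar>u m - v m\<bar>\<^sup>2))"
      by (rule sum_le_suminf) simp_all
    then have "ennreal (\<bar>u n - v n\<bar>\<^sup>2) \<le> (\<Sum>m. ennreal (\<bar>u m - v m\<bar>\<^sup>2))"
      by (simp only: sum.insert sum.empty finite.emptyI empty_iff not_False_eq_True add_0_right)
    with real show "\<bar>u n - v n\<bar>\<^sup>2 \<le> s" by simp
  qed
  then have "\<bar>(SUP n. \<bar>u n\<bar>) - (SUP n. \<bar>v n\<bar>)\<bar> \<le> sqrt s"
    by (rule abs_SUP_abs_diff_le [OF assms])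
  then have "\<bar>(SUP n. \<bar>u n\<bar>) - (SUP n. \<bar>v n\<bar>)\<bar>\<^sup>2 \<le> (sqrt s)\<^sup>2"
    by (rule power_mono) simp
  with real show ?thesis by (simp add: ennreal_leI)
qed simp

lemma energy_norm_lessD:
  assumes "energy_norm b c p f < ennreal \<delta>" "0 < \<delta>"
  shows "energy b c f \<le> ennreal (\<delta>\<^sup>2)" "\<bar>f p\<bar> \<le> \<delta>"
proof -
  \<comment> \<open>At infinite energy the norm is infinite by definition, so the default value of
    \<open>enn2real\<close> does not interfere.\<close>
  have fin: "energy b c f < \<infinity>"
    using assms by (auto simp: energy_norm_def split: if_splits)
  then obtain e where e: "energy b c f = ennreal e" "0 \<le> e"
    by (cases "energy b c f") auto
  with fin assms have "sqrt (e + \<bar>f p\<bar>\<^sup>2) < \<delta>"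
    by (simp add: energy_norm_def ennreal_less_iff)
  then have "(sqrt (e + \<bar>f p\<bar>\<^sup>2))\<^sup>2 < \<delta>\<^sup>2"
    using e(2) by (intro power_strict_mono) auto
  then have *: "e + \<bar>f p\<bar>\<^sup>2 < \<delta>\<^sup>2"
    using e(2) by simp
  then have "e \<le> \<delta>\<^sup>2"
    using zero_le_power2 [of "\<bar>f p\<bar>"] by linarith
  with e(1) show "energy b c f \<le> ennreal (\<delta>\<^sup>2)"
    by (simp add: ennreal_leI)
  from * e have "\<bar>f p\<bar>\<^sup>2 \<le> \<delta>\<^sup>2" by linarith
  then show "\<bar>f p\<bar> \<le> \<delta>"
    using assms(2) by (meson power2_le_imp_le order.strict_implies_order)
qed

text \<open>The domination is phrased as continuity at 0, the form needed for comparing the two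
  closures.\<close>

lemma sup_norm_small_of_energy_norm_small:
  assumes nonneg: "\<And>x y. 0 \<le> b x y" "\<And>x. 0 \<le> c x"
    and conn: "connected_graph b" and comp: "canonically_compactifiable b c"
    and "0 < \<epsilon>"
  shows "\<exists>\<delta>>0. \<forall>f. energy_norm b c p f < ennreal \<delta> \<longrightarrow> sup_norm f < ennreal \<epsilon>"
proof (rule ccontr)
  assume "\<not> ?thesis"
  then have "\<exists>f. energy_norm b c p f < ennreal ((1/4)^n) \<and> ennreal \<epsilon> \<le> sup_norm f" for n
    by (metis not_le zero_less_divide_1_iff zero_less_numeral zero_less_power)
  then obtain f where f: "\<And>n. energy_norm b c p (f n) < ennreal ((1/4)^n)"
      and large: "\<And>n. ennreal \<epsilon> \<le> sup_norm (f n)"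
    by metis
  have en: "energy b c (f n) \<le> ennreal ((1/16)^n)" and fp: "\<bar>f n p\<bar> \<le> (1/4)^n" for n
    using energy_norm_lessD [OF f [of n]]
    by (simp_all add: power_mult_distrib [symmetric] power2_eq_square)
  \<comment> \<open>The factor \<open>2^n\<close> drives the sup norms, at least
    \<open>2^n * \<epsilon>\<close>, to infinity, while the energies, at most
    \<open>(1/16)^n\<close>, are multiplied by \<open>4^n\<close> and remain summable.\<close>
  define h where "h n x = 2^n * f n x" for n x
  define g where "g x = (SUP n. \<bar>h n x\<bar>)" for x
  have square: "ennreal (\<bar>2^n * t\<bar>\<^sup>2) = ennreal (4^n) * ennreal (\<bar>t\<bar>\<^sup>2)" for n and t :: real
    by (simp add: power_mult_distrib ennreal_mult power_mult [symmetric] mult.commute [of n 2])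
      (simp add: power_mult)
  have scaled: "energy b c (h n) \<le> ennreal ((1/4)^n)" for n
  proof -
    \<comment> \<open>a one-term series, so that the domination lemma also yields homogeneity\<close>
    define k where "k m = (if m = 0 then ennreal (4^n) else 0)" for m :: nat
    have single: "(\<Sum>m. k m * t) = ennreal (4^n) * t" for t
      by (subst suminf_finite [of "{0}"]) (auto simp: k_def)
    have "energy b c (h n) \<le> (\<Sum>m. k m * energy b c (f n))"
      by (rule energy_le_suminf [OF nonneg])
        (simp_all only: single square h_def right_diff_distrib [symmetric] order_refl)
    also have "\<dots> \<le> ennreal (4^n) * ennreal ((1/16)^n)"
      unfolding single by (intro mult_left_mono en) simp
    also have "\<dots> = ennreal ((1/4)^n)"
      by (simp add: ennreal_mult [symmetric] power_mult_distrib [symmetric])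
    finally show ?thesis .
  qed
  have bdd: "bdd_above (range (\<lambda>n. \<bar>h n x\<bar>))" for x
  proof -
    obtain K where K: "\<And>f. energy b c f \<le> 1 \<Longrightarrow> \<bar>f p\<bar> \<le> 1 \<Longrightarrow> \<bar>f x\<bar> \<le> K"
      using point_evaluation_bounded [OF conn] by blast
    \<comment> \<open>Every \<open>h n\<close> has energy at most 1 and value at most 1 at
      \<open>p\<close>, so one \<open>K\<close> serves all \<open>n\<close>. This makes the
      real-valued \<open>SUP\<close> defining \<open>g\<close> a genuine supremum.\<close>
    have "\<bar>h n x\<bar> \<le> K" for n
    proof (rule K)
      have "(1/4 :: real)^n \<le> 1" by (simp add: power_le_one)
      then have "ennreal ((1/4)^n) \<le> 1" by simp
      with scaled show "energy b c (h n) \<le> 1" by (rule order_trans)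
      have "\<bar>h n p\<bar> \<le> 2^n * (1/4)^n"
        using fp [of n] by (simp add: h_def abs_mult)
      also have "\<dots> \<le> 1"
        by (simp add: power_mult_distrib [symmetric] power_le_one)
      finally show "\<bar>h n p\<bar> \<le> 1" .
    qed
    then show ?thesis by (intro bdd_aboveI2)
  qed
  have "energy b c g \<le> (\<Sum>n. 1 * energy b c (h n))"
  proof (rule energy_le_suminf [OF nonneg])
    show "ennreal (\<bar>g x - g y\<bar>\<^sup>2) \<le> (\<Sum>n. 1 * ennreal (\<bar>h n x - h n y\<bar>\<^sup>2))" for x y
      using abs_SUP_abs_diff_square_le_suminf [OF bdd bdd, of x y] by (simp add: g_def)
    fix x
    \<comment> \<open>Comparison with the zero sequence, whose supremum is 0, turns the difference
      estimate into the one for values.\<close>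
    have "bdd_above (range (\<lambda>n :: nat. \<bar>0 :: real\<bar>))" by auto
    from abs_SUP_abs_diff_square_le_suminf [OF bdd this, of x]
    show "ennreal (\<bar>g x\<bar>\<^sup>2) \<le> (\<Sum>n. 1 * ennreal (\<bar>h n x\<bar>\<^sup>2))"
      by (simp only: g_def abs_zero cSUP_const [OF UNIV_not_empty] diff_zero mult_1)
  qed
  also have "\<dots> \<le> (\<Sum>n. ennreal ((1/4)^n))"
    by (intro suminf_le) (simp_all add: scaled)
  also have "\<dots> < \<infinity>"
    unfolding infinity_ennreal_def less_top [symmetric]
    by (intro ennreal_suminf_neq_top summable_geometric) simp_all
  finally have "sup_norm g < \<infinity>"
    using comp by (auto simp: canonically_compactifiable_def finite_energy_functions_def
        bounded_functions_def)
  then obtain M where M: "sup_norm g = ennreal M" "0 \<le> M"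
    by (cases "sup_norm g") auto
  have gM: "g x \<le> M" for x
  proof -
    have "ennreal \<bar>g x\<bar> \<le> sup_norm g"
      unfolding sup_norm_def by (rule SUP_upper) simp
    with M show ?thesis by simp
  qed
  \<comment> \<open>The supremum in \<open>sup_norm\<close> need not be attained; passing to
    \<open>\<epsilon> / 2\<close> yields a strict inequality and thus an actual point
    \<open>x\<close>.\<close>
  obtain n where n: "M / (\<epsilon> / 2) < 2^n"
    using real_arch_pow [of 2] by auto
  have "ennreal (\<epsilon> / 2) < sup_norm (f n)"
    using \<open>0 < \<epsilon>\<close> by (intro less_le_trans [OF _ large]) (simp add: ennreal_less_iff)
  then obtain x where "\<epsilon> / 2 < \<bar>f n x\<bar>"
    using \<open>0 < \<epsilon>\<close> by (auto simp: sup_norm_def less_SUP_iff ennreal_less_iff)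
  then have "2^n * (\<epsilon> / 2) \<le> \<bar>h n x\<bar>"
    by (simp add: h_def abs_mult)
  also have "\<dots> \<le> M"
    using cSUP_upper [OF UNIV_I bdd, of n x] gM [of x] by (simp add: g_def)
  finally show False
    using n \<open>0 < \<epsilon>\<close> by (simp add: field_simps)
qed

theorem corollary2p3:
  fixes b :: "'a \<Rightarrow> 'a \<Rightarrow> real" and c :: "'a \<Rightarrow> real"
  assumes "countable (UNIV :: 'a set)" and "infinite (UNIV :: 'a set)"
    and "weighted_graph b c" and "connected_graph b"
    and "canonically_compactifiable b c"
  shows "uniformly_transient b c"
  unfolding uniformly_transient_def
proof (intro allI subsetI)
  fix p f assume f: "f \<in> finite_energy_functions0 b c p"
  have "\<exists>\<phi>\<in>finite_support_functions. sup_norm (\<lambda>x. f x - \<phi> x) < ennreal \<epsilon>"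
    if \<epsilon>: "0 < \<epsilon>" for \<epsilon> :: real
  proof -
    obtain \<delta> where "0 < \<delta>" and
      \<delta>: "\<And>h. energy_norm b c p h < ennreal \<delta> \<Longrightarrow> sup_norm h < ennreal \<epsilon>"
      using sup_norm_small_of_energy_norm_small [OF _ _ assms(4,5) \<epsilon>, of p] assms(3)
      unfolding weighted_graph_def by metis
    \<comment> \<open>Both closures approximate by the same set, so a \<phi> that is \<delta>-close
      to \<open>f\<close> in energy norm is itself the uniform approximant.\<close>
    with f obtain \<phi> where "\<phi> \<in> finite_support_functions"
        "energy_norm b c p (\<lambda>x. f x - \<phi> x) < ennreal \<delta>"
      unfolding finite_energy_functions0_def closure_in_def by blast
    with \<delta> show ?thesis by blast
  qed
  then show "f \<in> C0_functions"
    by (simp add: C0_functions_def closure_in_def)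
qed

end
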